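(* For any down-monotone polytope $P\subseteq\mathbb{R}^n_+$, an $\varepsilon$-approximated formulation in the original space can be obtained with inequalities using at most $O\left(\frac{1}{\varepsilon}\min\{\log(n/\varepsilon),\,n\}\right)$ different coefficients. Each of those coefficients is an integer between $0$ and $5n(1-\varepsilon)/\varepsilon$. In particular, there exists an $\varepsilon$-approximated formulation with $O\left(\frac{1}{\varepsilon}\min\{\log(n/\varepsilon),\,n\}\right)^n$ facets.
   Context: A polytope $P\subseteq\mathbb{R}^n_+$ is down-monotone if $x\in P$ and $0\le y\le x$ (coordinate-wise) imply $y\in P$. Given a polytope $P\subseteq\mathbb{R}^n$ and $\varepsilon>0$, a set $Q\subseteq\mathbb{R}^n$ is an $\varepsilon$-approximated formulation for $P$ if $P\subseteq Q$ and for each $c\in\mathbb{R}^n$, $$\max\{cx : x\in P\}\ \ge\ (1-\varepsilon)\max\{cx : x\in Q\},$$ where $cx=\sum_{i=1}^n c_ix_i$. "In the original space" means that $Q$ is described by linear inequalities in the variables $x_1,\dots,x_n$ of $\mathbb{R}^n$ itself, with no additional variables; the number of facets of $Q$ is the number of inequalities in a minimum linear description of $Q$.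
   Formalization: Coefficients refer to coordinates scaled by their maxima over P (the unscaled claim is false); P is nonempty, 0<ε<1; the coefficient claim assumes 5n(1-ε)/ε ≥ 1, and the facet claim assumes n ≥ 2 or 5n(1-ε)/ε ≥ 1. *)

theory Defs
  imports Complex_Main "Jordan_Normal_Form.Matrix"
begin

text \<open>
  The dimension \<open>n\<close> has to be a value, since the constant hidden in the O-notation is uniform
  in \<open>n\<close>; hence \<open>\<real>\<^sup>n\<close> is \<^term>\<open>carrier_vec n :: real vec set\<close>, with its coordinate-wise order.
\<close>

definition is_polytope :: "nat \<Rightarrow> real vec set \<Rightarrow> bool" where
  "is_polytope n P \<longleftrightarrow>
     (\<exists>V. finite V \<and> V \<subseteq> carrier_vec n \<and>
        P = {x \<in> carrier_vec n. \<exists>w. (\<forall>v\<in>V. 0 \<le> w v) \<and> (\<Sum>v\<in>V. w v) = 1 \<and>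
                                    (\<forall>i<n. x $ i = (\<Sum>v\<in>V. w v * v $ i))})"

definition down_monotone :: "nat \<Rightarrow> real vec set \<Rightarrow> bool" where
  "down_monotone n P \<longleftrightarrow>
     P \<subseteq> {x \<in> carrier_vec n. 0\<^sub>v n \<le> x} \<and>
     (\<forall>x\<in>P. \<forall>y\<in>carrier_vec n. 0\<^sub>v n \<le> y \<and> y \<le> x \<longrightarrow> y \<in> P)"

text \<open>Both maxima are required to be attained, at \<open>p\<close> and \<open>q\<close> respectively.\<close>

definition approx_formulation :: "nat \<Rightarrow> real \<Rightarrow> real vec set \<Rightarrow> real vec set \<Rightarrow> bool" where
  "approx_formulation n \<epsilon> P Q \<longleftrightarrow>
     P \<subseteq> Q \<and> Q \<subseteq> carrier_vec n \<and>
     (\<forall>c\<in>carrier_vec n. \<exists>p q.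
        is_arg_max (\<lambda>x. c \<bullet> x) (\<lambda>x. x \<in> P) p \<and>
        is_arg_max (\<lambda>x. c \<bullet> x) (\<lambda>x. x \<in> Q) q \<and>
        c \<bullet> p \<ge> (1 - \<epsilon>) * (c \<bullet> q))"

definition described_by :: "nat \<Rightarrow> nat \<Rightarrow> real vec set \<Rightarrow> bool" where
  "described_by n m Q \<longleftrightarrow>
     (\<exists>A\<in>carrier_mat m n. \<exists>b\<in>carrier_vec m. Q = {x \<in> carrier_vec n. A *\<^sub>v x \<le> b})"

definition is_polyhedron :: "nat \<Rightarrow> real vec set \<Rightarrow> bool" where
  "is_polyhedron n Q \<longleftrightarrow> (\<exists>m. described_by n m Q)"

text \<open>Only meaningful for polyhedra.\<close>

definition num_facets :: "nat \<Rightarrow> real vec set \<Rightarrow> nat" where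
  "num_facets n Q = (LEAST m. described_by n m Q)"

text \<open>
  A bound on the size of integer coefficients that does not depend on \<open>P\<close> presupposes that
  the coordinates are measured on a common scale.  The unit of the \<open>i\<close>-th coordinate is its maximum
  over \<open>P\<close>, or 1 if that coordinate vanishes on \<open>P\<close>.  If all these maxima are 0 or 1, as
  for 0/1 polytopes, then \<open>normalize_coords P\<close> is the identity (see below).
\<close>

definition coord_unit :: "real vec set \<Rightarrow> nat \<Rightarrow> real" where
  "coord_unit P i = (if \<exists>x\<in>P. x $ i \<noteq> 0 then SUP x\<in>P. x $ i else 1)"

definition normalize_coords :: "real vec set \<Rightarrow> real vec \<Rightarrow> real vec" where
  "normalize_coords P x = vec (dim_vec x) (\<lambda>i. x $ i / coord_unit P i)"

lemma normalize_coords_id: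
  assumes "x \<in> carrier_vec n" and "\<And>i. i < n \<Longrightarrow> (SUP y\<in>P. y $ i) = 1 \<or> (\<forall>y\<in>P. y $ i = 0)"
  shows "normalize_coords P x = x"
proof -
  have "coord_unit P i = 1" if "i < n" for i
    using assms(2)[OF that] by (auto simp: coord_unit_def)
  then show ?thesis
    using assms(1) by (auto simp: normalize_coords_def)
qed

text \<open>
  The set \<open>S\<close> collects the coefficients of all inequalities, including the 0s and 1s of the
  nonnegativity constraints \<open>x\<^sub>i \<ge> 0\<close>.  Right-hand sides are arbitrary reals.
\<close>

definition described_with_coeffs ::
  "nat \<Rightarrow> real vec set \<Rightarrow> int set \<Rightarrow> real vec set \<Rightarrow> bool" where
  "described_with_coeffs n P S Q \<longleftrightarrow>
     {0, 1} \<subseteq> S \<and>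
     (\<exists>m. \<exists>A\<in>carrier_mat m n. \<exists>b\<in>carrier_vec m.
        elements_mat A \<subseteq> real_of_int ` S \<and>
        Q = {x \<in> carrier_vec n. 0\<^sub>v n \<le> x \<and> A *\<^sub>v normalize_coords P x \<le> b})"

definition coeff_rate :: "nat \<Rightarrow> real \<Rightarrow> real" where
  "coeff_rate n \<epsilon> = 1 / \<epsilon> * min (ln (real n / \<epsilon>)) (real n)"

definition coeff_limit :: "nat \<Rightarrow> real \<Rightarrow> real" where
  "coeff_limit n \<epsilon> = 5 * real n * (1 - \<epsilon>) / \<epsilon>"

end

theory Submission
  imports Defs "HOL-Analysis.Function_Topology"
begin

text \<open>
  The approximation is the set of nonnegative points satisfying every inequality
  \<open>\<Sum>\<^sub>i a\<^sub>i x\<^sub>i \<le> max\<^sub>P\<close> with \<open>a \<in> S\<^sup>n\<close>, in coordinates scaled so that each has maximum 1 (or 0) on \<open>P\<close>.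
  Here \<open>S\<close> consists of 0 and the integer parts of the powers of \<open>1 + \<delta>\<close> up to about
  \<open>5n(1 - \<epsilon>)/\<epsilon>\<close>, with \<open>\<delta>\<close> proportional to \<open>min (\<epsilon>/(1 - \<epsilon>)) 1\<close>: rounding an objective to \<open>S\<^sup>n\<close>
  costs a relative error \<open>\<delta>\<close> plus an absolute error of order \<open>\<epsilon>/(n(1 - \<epsilon>))\<close> times the largest coefficient
  in each coordinate, together at most a factor \<open>1/(1 - \<epsilon>)\<close>.
\<close>

section \<open>Rounding to a geometric set of integers\<close>

text \<open>Taking integer parts merges the crowded small powers, so the set never exceeds the
  number of integers up to \<open>N\<close>, while for large \<open>N\<close> its size grows only
  logarithmically. The element 0 serves values below 1.\<close>

definition geometric_floors :: "real \<Rightarrow> nat \<Rightarrow> int set" where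
  "geometric_floors \<delta> N = insert 0 ((\<lambda>k. \<lfloor>(1 + \<delta>) ^ k\<rfloor>) ` {k::nat. (1 + \<delta>) ^ k \<le> real N})"

lemma ln_one_plus_ge_half:
  fixes x :: real
  assumes "0 \<le> x" "x \<le> 1"
  shows "x / 2 \<le> ln (1 + x)"
proof -
  have "ln 1 - ln (1 + x) \<le> (1 - (1 + x)) / (1 + x)"
    using assms by (intro ln_diff_le) auto
  then have "x / (1 + x) \<le> ln (1 + x)" by simp
  moreover have "x / 2 \<le> x / (1 + x)"
    using assms by (intro divide_left_mono) auto
  ultimately show ?thesis by linarith
qed

lemma geometric_floors_bounds: "0 \<le> \<delta> \<Longrightarrow> geometric_floors \<delta> N \<subseteq> {0..int N}"
  by (auto simp: geometric_floors_def floor_le_iff)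

lemma geometric_floors_0_1:
  assumes "1 \<le> N"
  shows "{0, 1} \<subseteq> geometric_floors \<delta> N"
proof -
  have "\<lfloor>(1 + \<delta>) ^ 0\<rfloor> \<in> geometric_floors \<delta> N"
    unfolding geometric_floors_def using assms by (intro insertI2 imageI) auto
  then show ?thesis by (simp add: geometric_floors_def)
qed

text \<open>This crude count yields the \<open>n\<close> branch of the minimum in
  \<open>coeff_rate\<close>.\<close>

lemma card_geometric_floors_le_Suc:
  assumes "0 \<le> \<delta>"
  shows "card (geometric_floors \<delta> N) \<le> N + 1"
  using card_mono[OF _ geometric_floors_bounds[OF assms, of N]] by simp

text \<open>Admissible exponents satisfy k \<le> ln N / ln (1 + \<delta>) \<le> 2 ln N / \<delta>,
  the last step because \<delta> \<le> 1. The summand 2 accounts for the exponent 0 and the element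
  0.\<close>

lemma card_geometric_floors_le_ln:
  assumes "0 < \<delta>" "\<delta> \<le> 1" "1 \<le> N"
  shows "real (card (geometric_floors \<delta> N)) \<le> 2 + 2 * ln (real N) / \<delta>"
proof -
  let ?K = "{k::nat. (1 + \<delta>) ^ k \<le> real N}" and ?b = "2 * ln (real N) / \<delta>"
  have b0: "0 \<le> ?b" using assms by simp
  have sub: "?K \<subseteq> {..nat \<lfloor>?b\<rfloor>}"
  proof
    fix k assume "k \<in> ?K"
    then have "ln ((1 + \<delta>) ^ k) \<le> ln (real N)"
      using assms by simp
    then have "real k * ln (1 + \<delta>) \<le> ln (real N)"
      using assms by (simp add: ln_realpow)
    moreover have "real k * (\<delta> / 2) \<le> real k * ln (1 + \<delta>)"
      using assms by (intro mult_left_mono ln_one_plus_ge_half) auto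
    ultimately have "real k \<le> ?b"
      using assms by (simp add: field_simps)
    then show "k \<in> {..nat \<lfloor>?b\<rfloor>}"
      by (simp add: le_nat_floor)
  qed
  then have fin: "finite ?K" by (rule finite_subset) simp
  have "card (geometric_floors \<delta> N) \<le> Suc (card ?K)"
    unfolding geometric_floors_def
    using card_image_le[OF fin] fin
    by (metis (no_types, lifting) card_insert_if finite_imageI le_SucI not_less_eq_eq)
  also have "card ?K \<le> nat \<lfloor>?b\<rfloor> + 1"
    using card_mono[OF _ sub] by simp
  finally have "real (card (geometric_floors \<delta> N)) \<le> real (nat \<lfloor>?b\<rfloor>) + 2"
    by linarith
  moreover have "real (nat \<lfloor>?b\<rfloor>) \<le> ?b"
    using b0 by (rule of_nat_floor)
  ultimately show ?thesis by linarith
qed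

text \<open>After scaling by \<open>N\<close>, the value is rounded down to a power of 1 + \<delta>,
  which costs the factor 1 + \<delta>; the integer part then loses less than 1, which is the
  additive term (1 + \<delta>)/N.\<close>

lemma geometric_floors_round:
  assumes "0 < \<delta>" "1 \<le> N" "0 \<le> t" "t \<le> 1"
  shows "\<exists>a\<in>geometric_floors \<delta> N. 1 / real N * real_of_int a \<le> t \<and>
    t \<le> (1 + \<delta>) * (1 / real N * real_of_int a) + (1 + \<delta>) / real N"
proof -
  define s where "s = t * real N"
  have N: "real N > 0" using assms by simp
  have *: ?thesis if "a \<in> geometric_floors \<delta> N" "real_of_int a \<le> s" "s \<le> (1 + \<delta>) * (real_of_int a + 1)" for a
  proof (intro bexI[of _ a] conjI that(1))
    show "1 / real N * real_of_int a \<le> t"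
      using that(2) N by (simp add: s_def field_simps)
    have "t = s / real N" using N by (simp add: s_def)
    also have "\<dots> \<le> (1 + \<delta>) * (real_of_int a + 1) / real N"
      using that(3) N by (intro divide_right_mono) auto
    finally show "t \<le> (1 + \<delta>) * (1 / real N * real_of_int a) + (1 + \<delta>) / real N"
      by (simp add: distrib_left add_divide_distrib)
  qed
  show ?thesis
  proof (cases "s < 1")
    case True
    have "0 \<le> s" using assms by (simp add: s_def)
    with True show ?thesis
      using assms by (intro *[of 0]) (auto simp: geometric_floors_def)
  next
    case False
    \<comment> \<open>The largest exponent with (1 + \<delta>)^k \<le> s. Since s \<ge> 1, the
      logarithm is nonnegative and \<open>nat\<close> truncates nothing.\<close>
    define k where "k = nat \<lfloor>log (1 + \<delta>) s\<rfloor>"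
    have "0 \<le> log (1 + \<delta>) s" using False assms by simp
    then have k: "real k \<le> log (1 + \<delta>) s" "log (1 + \<delta>) s < real (Suc k)"
      unfolding k_def by linarith+
    have lo: "(1 + \<delta>) ^ k \<le> s"
      using k(1) False assms by (simp add: le_log_iff powr_realpow)
    have "s < (1 + \<delta>) powr real (Suc k)"
      using k(2) False assms by (subst (asm) log_less_iff) auto
    then have hi: "s < (1 + \<delta>) ^ Suc k"
      using assms by (subst (asm) powr_realpow) auto
    have "s \<le> real N"
      unfolding s_def using assms N by (simp add: mult_left_le_one_le)
    show ?thesis
    proof (rule *[of "\<lfloor>(1 + \<delta>) ^ k\<rfloor>"])
      show "\<lfloor>(1 + \<delta>) ^ k\<rfloor> \<in> geometric_floors \<delta> N"
        using lo \<open>s \<le> real N\<close> by (auto simp: geometric_floors_def)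
      show "real_of_int \<lfloor>(1 + \<delta>) ^ k\<rfloor> \<le> s"
        using lo by linarith
      have "(1 + \<delta>) ^ k \<le> real_of_int \<lfloor>(1 + \<delta>) ^ k\<rfloor> + 1" by linarith
      then have "(1 + \<delta>) * (1 + \<delta>) ^ k \<le> (1 + \<delta>) * (real_of_int \<lfloor>(1 + \<delta>) ^ k\<rfloor> + 1)"
        using assms by (intro mult_left_mono) auto
      then show "s \<le> (1 + \<delta>) * (real_of_int \<lfloor>(1 + \<delta>) ^ k\<rfloor> + 1)"
        using hi by simp
    qed
  qed
qed

section \<open>Finite systems of inequalities\<close>

text \<open>The index set is enumerated to give the rows of a matrix. The bound on the entries is
  what later certifies that only coefficients from the chosen set occur.\<close>

lemma finite_system_as_matrix:
  fixes \<alpha> :: "'k \<Rightarrow> nat \<Rightarrow> real"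
  assumes "finite I"
  obtains A b where "A \<in> carrier_mat (card I) n" "b \<in> carrier_vec (card I)"
    "elements_mat A \<subseteq> {\<alpha> k i |k i. k \<in> I \<and> i < n}"
    "\<And>y. y \<in> carrier_vec n \<Longrightarrow>
       A *\<^sub>v y \<le> b \<longleftrightarrow> (\<forall>k\<in>I. (\<Sum>i<n. \<alpha> k i * y $ i) \<le> \<beta> k)"
proof -
  obtain h where h: "bij_betw h {0..<card I} I"
    using ex_bij_betw_nat_finite[OF assms] by blast
  define A where "A = mat (card I) n (\<lambda>(j, i). \<alpha> (h j) i)"
  define b where "b = vec (card I) (\<lambda>j. \<beta> (h j))"
  have hI: "h j \<in> I" if "j < card I" for j
    using h that by (auto simp: bij_betw_def)
  have I: "I = h ` {..<card I}"
    using h by (auto simp: bij_betw_def lessThan_atLeast0)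
  show thesis
  proof (rule that)
    show "A \<in> carrier_mat (card I) n" "b \<in> carrier_vec (card I)"
      by (auto simp: A_def b_def)
    show "elements_mat A \<subseteq> {\<alpha> k i |k i. k \<in> I \<and> i < n}"
      using hI by (fastforce simp: A_def dest!: elements_matD)
    fix y :: "real vec" assume y: "y \<in> carrier_vec n"
    have row: "(A *\<^sub>v y) $ j = (\<Sum>i<n. \<alpha> (h j) i * y $ i)" if "j < card I" for j
      using that y by (auto simp: A_def scalar_prod_def lessThan_atLeast0 intro!: sum.cong)
    have "A *\<^sub>v y \<le> b \<longleftrightarrow> (\<forall>j<card I. (\<Sum>i<n. \<alpha> (h j) i * y $ i) \<le> \<beta> (h j))"
      using row by (auto simp: less_eq_vec_def A_def b_def)
    also have "\<dots> \<longleftrightarrow> (\<forall>k\<in>I. (\<Sum>i<n. \<alpha> k i * y $ i) \<le> \<beta> k)"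
      by (subst I) auto
    finally show "A *\<^sub>v y \<le> b \<longleftrightarrow> (\<forall>k\<in>I. (\<Sum>i<n. \<alpha> k i * y $ i) \<le> \<beta> k)" .
  qed
qed

lemma finite_system_described_by:
  assumes "finite I"
    and "Q = {x \<in> carrier_vec n. \<forall>k\<in>I. (\<Sum>i<n. \<alpha> k i * x $ i) \<le> \<beta> k}"
  shows "described_by n (card I) Q"
proof -
  obtain A b where "A \<in> carrier_mat (card I) n" "b \<in> carrier_vec (card I)"
    "\<And>y. y \<in> carrier_vec n \<Longrightarrow>
       A *\<^sub>v y \<le> b \<longleftrightarrow> (\<forall>k\<in>I. (\<Sum>i<n. \<alpha> k i * y $ i) \<le> \<beta> k)"
    by (rule finite_system_as_matrix[OF assms(1), of n \<alpha> \<beta>]) blast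
  then show ?thesis
    unfolding described_by_def assms(2) by blast
qed

lemma num_facets_le: "described_by n m Q \<Longrightarrow> num_facets n Q \<le> m"
  unfolding num_facets_def by (rule Least_le)

text \<open>Points are extended by 0 to functions on all of \<open>nat\<close>. There the box is
  compact by Tychonoff's theorem, the half-spaces are closed, and a linear form in finitely many
  coordinates is continuous.\<close>

lemma bounded_system_attains_max:
  fixes c u :: "nat \<Rightarrow> real" and \<alpha> :: "'k \<Rightarrow> nat \<Rightarrow> real"
  assumes "\<And>x. x \<in> Q \<longleftrightarrow> x \<in> carrier_vec n \<and> (\<forall>i<n. 0 \<le> x $ i) \<and>
      (\<forall>k\<in>I. (\<Sum>i<n. \<alpha> k i * x $ i) \<le> \<beta> k)"
    and bound: "\<And>x i. x \<in> Q \<Longrightarrow> i < n \<Longrightarrow> x $ i \<le> u i"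
    and "Q \<noteq> {}"
  obtains q where "q \<in> Q" "\<And>x. x \<in> Q \<Longrightarrow> (\<Sum>i<n. c i * x $ i) \<le> (\<Sum>i<n. c i * q $ i)"
proof -
  \<comment> \<open>Pinning the coordinates from \<open>n\<close> on to 0 makes every factor of the
    product compact.\<close>
  define B :: "(nat \<Rightarrow> real) set"
    where "B = PiE UNIV (\<lambda>i. if i < n then {0..u i} else {0})"
  define H :: "'k \<Rightarrow> (nat \<Rightarrow> real) set" where "H k = {f. (\<Sum>i<n. \<alpha> k i * f i) \<le> \<beta> k}" for k
  have "compactin (product_topology (\<lambda>i. euclidean) UNIV) B"
    unfolding B_def by (subst compactin_PiE) auto
  then have "compact B"
    by (simp add: euclidean_product_topology)
  have cont: "continuous_on UNIV (\<lambda>f::nat \<Rightarrow> real. \<Sum>i<n. d i * f i)" for d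
    by (intro continuous_intros continuous_on_product_coordinates)
  have "closed (H k)" for k
    unfolding H_def using cont by (intro closed_Collect_le) auto
  then have "closed (\<Inter>k\<in>I. H k)" by auto
  with \<open>compact B\<close> have K: "compact (B \<inter> (\<Inter>k\<in>I. H k))"
    by (rule compact_Int_closed)
  define g where "g x = (\<lambda>i. if i < n then x $ i else (0::real))" for x
  have g: "g x \<in> B \<inter> (\<Inter>k\<in>I. H k)" if "x \<in> Q" for x
    using that bound[OF that] assms(1)[of x] by (auto simp: B_def H_def g_def)
  then have "B \<inter> (\<Inter>k\<in>I. H k) \<noteq> {}" using assms(3) by blast
  from continuous_attains_sup[OF K this continuous_on_subset[OF cont[of c] subset_UNIV]]
  obtain f where f: "f \<in> B \<inter> (\<Inter>k\<in>I. H k)"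
    and max: "\<And>f'. f' \<in> B \<inter> (\<Inter>k\<in>I. H k) \<Longrightarrow> (\<Sum>i<n. c i * f' i) \<le> (\<Sum>i<n. c i * f i)"
    by (elim bexE) auto
  have f0: "0 \<le> f i" if "i < n" for i
  proof -
    have "f i \<in> (if i < n then {0..u i} else {0})"
      using f unfolding B_def by blast
    then show ?thesis using that by simp
  qed
  show thesis
  proof (rule that)
    show "vec n f \<in> Q"
      using f f0 by (subst assms(1)) (auto simp: H_def)
    fix x assume "x \<in> Q"
    then show "(\<Sum>i<n. c i * x $ i) \<le> (\<Sum>i<n. c i * vec n f $ i)"
      using max[OF g[of x]] by (simp add: g_def)
  qed
qed

section \<open>Down-monotone polytopes\<close>

text \<open>A linear form at a convex combination is the weighted mean of its values on the
  generators \<open>V\<close>, so the best generator is optimal.\<close>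

lemma polytope_attains_max:
  assumes "is_polytope n P" "P \<noteq> {}"
  obtains p where "p \<in> P" "\<And>x. x \<in> P \<Longrightarrow> (\<Sum>i<n. c i * x $ i) \<le> (\<Sum>i<n. c i * p $ i)"
proof -
  obtain V where V: "finite V" "V \<subseteq> carrier_vec n"
    and P: "P = {x \<in> carrier_vec n. \<exists>w. (\<forall>v\<in>V. 0 \<le> w v) \<and> (\<Sum>v\<in>V. w v) = 1 \<and>
                                    (\<forall>i<n. x $ i = (\<Sum>v\<in>V. w v * v $ i))}"
    using assms(1) unfolding is_polytope_def by blast
  define l where "l x = (\<Sum>i<n. c i * x $ i)" for x
  have "V \<noteq> {}" using assms(2) P by auto
  then have "Max (l ` V) \<in> l ` V"
    using V(1) by (intro Max_in) auto
  then obtain p where p: "p \<in> V" "l p = Max (l ` V)" by (metis imageE)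
  then have lp: "l v \<le> l p" if "v \<in> V" for v
    using V(1) that by simp
  \<comment> \<open>The weights concentrated at \<open>p\<close> exhibit \<open>p\<close> as a
    member of \<open>P\<close>.\<close>
  have "(\<Sum>v\<in>V. (if v = p then 1 else 0) * f v) = f p" for f :: "real vec \<Rightarrow> real"
    using V(1) p(1) by (simp add: if_distrib[of "\<lambda>x. x * _"] cong: if_cong)
  note delta = this this[of "\<lambda>_. 1"]
  show thesis
  proof (rule that)
    show "p \<in> P"
      unfolding P using p(1) V(2) delta
      by (auto intro!: exI[of _ "\<lambda>v. if v = p then 1 else 0"])
    fix x assume "x \<in> P"
    then obtain w where w: "\<forall>v\<in>V. 0 \<le> w v" "(\<Sum>v\<in>V. w v) = 1"
      "\<forall>i<n. x $ i = (\<Sum>v\<in>V. w v * v $ i)"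
      unfolding P by blast
    have "l x = (\<Sum>i<n. \<Sum>v\<in>V. w v * (c i * v $ i))"
      using w(3) by (simp add: l_def sum_distrib_left mult_ac)
    also have "\<dots> = (\<Sum>v\<in>V. w v * l v)"
      by (subst sum.swap) (simp add: l_def sum_distrib_left)
    also have "\<dots> \<le> (\<Sum>v\<in>V. w v * l p)"
      using w(1) lp by (intro sum_mono mult_left_mono) auto
    also have "\<dots> = l p" using w(2) by (simp flip: sum_distrib_right)
    finally show "(\<Sum>i<n. c i * x $ i) \<le> (\<Sum>i<n. c i * p $ i)" by (simp add: l_def)
  qed
qed

locale monotone_polytope =
  fixes n :: nat and P :: "real vec set"
  assumes polytope: "is_polytope n P" and ne: "P \<noteq> {}" and down: "down_monotone n P"
begin

section \<open>Coordinate units\<close>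

abbreviation u :: "nat \<Rightarrow> real" where "u \<equiv> coord_unit P"

lemma subset_nonneg: "P \<subseteq> {x \<in> carrier_vec n. 0\<^sub>v n \<le> x}"
  using down unfolding down_monotone_def by (rule conjunct1)

lemma carrier: "x \<in> P \<Longrightarrow> x \<in> carrier_vec n"
  using subset_nonneg by blast

lemma nonneg:
  assumes "x \<in> P" "i < n"
  shows "0 \<le> x $ i"
proof -
  have "x \<in> carrier_vec n" "0\<^sub>v n \<le> x" using subset_nonneg assms(1) by auto
  then show ?thesis using assms(2) by (simp add: less_eq_vec_def)
qed

text \<open>Maximizing the single coordinate \<open>i\<close> shows that the supremum in
  \<open>coord_unit\<close> is attained; by nonnegativity it is positive as soon as the coordinate
  does not vanish on \<open>P\<close>.\<close>

lemma unit_cases: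
  assumes "i < n"
  obtains (pos) p where "0 < u i" "p \<in> P" "p $ i = u i" "\<And>x. x \<in> P \<Longrightarrow> x $ i \<le> u i"
  | (zero) "u i = 1" "\<And>x. x \<in> P \<Longrightarrow> x $ i = 0"
proof (cases "\<exists>x\<in>P. x $ i \<noteq> 0")
  case True
  obtain p where p: "p \<in> P"
    "\<And>x. x \<in> P \<Longrightarrow> (\<Sum>j<n. (if j = i then 1 else 0) * x $ j) \<le> (\<Sum>j<n. (if j = i then 1 else 0) * p $ j)"
    by (rule polytope_attains_max[OF polytope ne, of "\<lambda>j. if j = i then 1 else 0"]) blast
  have max: "x $ i \<le> p $ i" if "x \<in> P" for x
    using p(2)[OF that] assms by (simp add: if_distrib[of "\<lambda>x. x * _"] cong: if_cong)
  then have "(SUP x\<in>P. x $ i) = p $ i"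
    using p(1) by (intro cSup_eq_maximum) auto
  then have u: "u i = p $ i" using True by (simp add: coord_unit_def)
  obtain x where "x \<in> P" "x $ i \<noteq> 0" using True by blast
  then have "0 < p $ i" using nonneg[of x i] assms max[of x] by linarith
  then show thesis using u p(1) max by (intro pos[of p]) auto
next
  case False
  then show thesis by (intro zero) (auto simp: coord_unit_def)
qed

lemma unit_pos:
  assumes "i < n"
  shows "0 < u i"
  using assms
proof (cases rule: unit_cases)
  case (pos p)
  then show ?thesis by simp
next
  case zero
  then show ?thesis by simp
qed

lemma le_unit:
  assumes "x \<in> P" "i < n"
  shows "x $ i \<le> u i"
  using assms(2)
proof (cases rule: unit_cases)
  case (pos p)
  then show ?thesis using assms(1) by blast
next
  case zero
  then show ?thesis using assms(1) by simp
qed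

section \<open>The relaxation and its approximation quality\<close>

text \<open>The support function of \<open>P\<close> in the direction a_i / u_i, hence the tightest
  right-hand side valid on \<open>P\<close>.\<close>

definition rhs :: "(nat \<Rightarrow> int) \<Rightarrow> real" where
  "rhs a = (SUP x\<in>P. \<Sum>i<n. real_of_int (a i) / u i * x $ i)"

text \<open>The normalization is absorbed into the coefficients a_i / u_i. Extensional functions
  represent S^n, so that a finite \<open>S\<close> gives exactly |S|^n inequalities of this
  kind.\<close>

definition relaxation :: "int set \<Rightarrow> real vec set" where
  "relaxation S = {x \<in> carrier_vec n. (\<forall>i<n. 0 \<le> x $ i) \<and>
     (\<forall>a \<in> {..<n} \<rightarrow>\<^sub>E S. (\<Sum>i<n. real_of_int (a i) / u i * x $ i) \<le> rhs a)}"

lemma rhs_attained: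
  obtains p where "p \<in> P" "rhs a = (\<Sum>i<n. real_of_int (a i) / u i * p $ i)"
    "\<And>x. x \<in> P \<Longrightarrow> (\<Sum>i<n. real_of_int (a i) / u i * x $ i) \<le> rhs a"
proof -
  obtain p where p: "p \<in> P" "\<And>x. x \<in> P \<Longrightarrow>
      (\<Sum>i<n. real_of_int (a i) / u i * x $ i) \<le> (\<Sum>i<n. real_of_int (a i) / u i * p $ i)"
    by (rule polytope_attains_max[OF polytope ne, of "\<lambda>i. real_of_int (a i) / u i"]) blast
  then have "rhs a = (\<Sum>i<n. real_of_int (a i) / u i * p $ i)"
    unfolding rhs_def by (intro cSup_eq_maximum) auto
  with p that show thesis by auto
qed

lemma subset_relaxation: "P \<subseteq> relaxation S"
proof
  fix x assume x: "x \<in> P"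
  have "(\<Sum>i<n. real_of_int (a i) / u i * x $ i) \<le> rhs a" for a
    by (rule rhs_attained[of a]) (use x in auto)
  then show "x \<in> relaxation S"
    using x carrier nonneg by (auto simp: relaxation_def)
qed

text \<open>The unit vectors belong to S^n, so the relaxation lies in the bounding box of
  \<open>P\<close>. In particular it is bounded, and coordinates vanishing on \<open>P\<close>
  vanish on it as well.\<close>

lemma relaxation_coord_bound:
  assumes "{0, 1} \<subseteq> S" "x \<in> relaxation S" "i < n"
  obtains p where "p \<in> P" "x $ i \<le> p $ i"
proof -
  define a :: "nat \<Rightarrow> int"
    where "a = (\<lambda>j. if j < n then if j = i then 1 else 0 else undefined)"
  have a: "a \<in> {..<n} \<rightarrow>\<^sub>E S" using assms(1) by (auto simp: a_def split: if_splits)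
  have sum: "(\<Sum>j<n. real_of_int (a j) / u j * y $ j) = y $ i / u i" for y
  proof -
    have "(\<Sum>j<n. real_of_int (a j) / u j * y $ j) = (\<Sum>j<n. if j = i then y $ j / u j else 0)"
      by (intro sum.cong) (auto simp: a_def)
    then show ?thesis using assms(3) by simp
  qed
  obtain p where p: "p \<in> P" "rhs a = p $ i / u i"
    using rhs_attained[of a] sum by metis
  have "x $ i / u i \<le> rhs a"
    using assms(2) a sum[of x] by (auto simp: relaxation_def)
  then have "x $ i \<le> p $ i"
    using p(2) unit_pos[OF assms(3)] by (simp add: divide_le_cancel)
  with p(1) show thesis by (rule that)
qed

lemma relaxation_attains_max:
  assumes "{0, 1} \<subseteq> S"
  obtains q where "q \<in> relaxation S"
    "\<And>x. x \<in> relaxation S \<Longrightarrow> (\<Sum>i<n. c i * x $ i) \<le> (\<Sum>i<n. c i * q $ i)"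
proof (rule bounded_system_attains_max[where Q = "relaxation S" and n = n and u = u and c = c
      and I = "{..<n} \<rightarrow>\<^sub>E S" and \<alpha> = "\<lambda>a i. real_of_int (a i) / u i" and \<beta> = rhs])
  show "relaxation S \<noteq> {}" using ne subset_relaxation by blast
  show "x $ i \<le> u i" if xi: "x \<in> relaxation S" "i < n" for x i
  proof (rule relaxation_coord_bound[OF assms xi])
    fix p assume "p \<in> P" "x $ i \<le> p $ i"
    then show "x $ i \<le> u i" using le_unit[of p i] xi(2) by linarith
  qed
  show "x \<in> relaxation S \<longleftrightarrow> x \<in> carrier_vec n \<and> (\<forall>i<n. 0 \<le> x $ i) \<and>
      (\<forall>a\<in>{..<n} \<rightarrow>\<^sub>E S. (\<Sum>i<n. real_of_int (a i) / u i * x $ i) \<le> rhs a)" for x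
    by (simp add: relaxation_def)
qed (rule that)

text \<open>Coordinates with a negative objective coefficient, and those vanishing on \<open>P\<close>, can be dropped;
  after dividing the rest by its largest entry \<open>M\<close> it is rounded to \<open>a \<in> S\<^sup>n\<close>, and the
  rounding error is paid for by \<open>M \<le> max\<^sub>P\<close>.\<close>

lemma relaxation_approx:
  assumes n: "1 \<le> n" and S: "{0, 1} \<subseteq> S" and \<nu>: "0 \<le> \<nu>" and \<delta>: "0 \<le> \<delta>" and \<eta>: "0 \<le> \<eta>"
    and round: "\<And>t. 0 \<le> t \<Longrightarrow> t \<le> 1 \<Longrightarrow>
      \<exists>a\<in>S. \<nu> * real_of_int a \<le> t \<and> t \<le> (1 + \<delta>) * (\<nu> * real_of_int a) + \<eta>"
    and \<epsilon>: "\<epsilon> < 1" "\<delta> + real n * \<eta> \<le> \<epsilon> / (1 - \<epsilon>)"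
  shows "approx_formulation n \<epsilon> P (relaxation S)"
  unfolding approx_formulation_def
proof (intro conjI ballI)
  show "P \<subseteq> relaxation S" by (rule subset_relaxation)
  show "relaxation S \<subseteq> carrier_vec n" by (auto simp: relaxation_def)
  fix c :: "real vec" assume c: "c \<in> carrier_vec n"
  have dot: "c \<bullet> x = (\<Sum>i<n. c $ i * x $ i)" if "x \<in> carrier_vec n" for x
    using that by (auto simp: scalar_prod_def lessThan_atLeast0)
  obtain q where q: "q \<in> relaxation S"
    "\<And>x. x \<in> relaxation S \<Longrightarrow> (\<Sum>i<n. c $ i * x $ i) \<le> (\<Sum>i<n. c $ i * q $ i)"
    by (rule relaxation_attains_max[OF S, of "\<lambda>i. c $ i"]) blast
  define d where "d i = (if c $ i < 0 \<or> (\<forall>x\<in>P. x $ i = 0) then 0 else c $ i)" for i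
  have d0: "0 \<le> d i" for i by (auto simp: d_def)
  \<comment> \<open>Replacing \<open>c\<close> by \<open>d\<close> never lowers the objective on the
    relaxation: a dropped coordinate has a negative coefficient and x_i \<ge> 0, or it is
    identically 0 there.\<close>
  have drop: "c $ i * x $ i \<le> d i * x $ i" if xi: "x \<in> relaxation S" "i < n" for x i
  proof -
    have x0: "0 \<le> x $ i" using xi by (auto simp: relaxation_def)
    obtain p where "p \<in> P" "x $ i \<le> p $ i"
      by (rule relaxation_coord_bound[OF S xi])
    then have "x $ i = 0" if "\<forall>x\<in>P. x $ i = 0" using that x0 by auto
    then show ?thesis
      using x0 by (auto simp: d_def intro!: mult_nonpos_nonneg)
  qed
  obtain p0 where p0: "p0 \<in> P" "\<And>x. x \<in> P \<Longrightarrow> (\<Sum>i<n. d i * x $ i) \<le> (\<Sum>i<n. d i * p0 $ i)"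
    by (rule polytope_attains_max[OF polytope ne, of d]) blast
  define z where "z = (\<Sum>i<n. d i * p0 $ i)"
  \<comment> \<open>Down-monotonicity allows the coordinates with negative cost to be set to 0. The
    resulting point attains \<open>z\<close> under \<open>c\<close> itself, so \<open>z\<close> is
    the maximum of both \<open>c\<close> and \<open>d\<close> over \<open>P\<close>.\<close>
  define p where "p = vec n (\<lambda>i. if c $ i < 0 then 0 else p0 $ i)"
  have "p \<le> p0" "0\<^sub>v n \<le> p" "p \<in> carrier_vec n"
    using carrier[OF p0(1)] nonneg[OF p0(1)] by (auto simp: p_def less_eq_vec_def)
  then have pP: "p \<in> P"
    using down p0(1) by (auto simp: down_monotone_def)
  have cp: "(\<Sum>i<n. c $ i * p $ i) = z"
    unfolding z_def by (intro sum.cong) (use p0(1) in \<open>auto simp: p_def d_def\<close>)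
  have pmax: "(\<Sum>i<n. c $ i * x $ i) \<le> z" if "x \<in> P" for x
  proof -
    have "(\<Sum>i<n. c $ i * x $ i) \<le> (\<Sum>i<n. d i * x $ i)"
      using that subset_relaxation by (intro sum_mono drop) auto
    then show ?thesis using p0(2)[OF that] by (simp add: z_def)
  qed

  define M where "M = Max ((\<lambda>i. d i * u i) ` {..<n})"
  have Mge: "d i * u i \<le> M" if "i < n" for i
    unfolding M_def using that by (intro Max_ge) auto
  have M0: "0 \<le> M"
  proof -
    have "0 \<le> d 0 * u 0" using d0 unit_pos[of 0] n by (intro mult_nonneg_nonneg) auto
    also have "\<dots> \<le> M" using n by (intro Mge) auto
    finally show ?thesis .
  qed
  have z0: "0 \<le> z"
    unfolding z_def using d0 nonneg[OF p0(1)] by (intro sum_nonneg mult_nonneg_nonneg) auto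
  \<comment> \<open>Some point of \<open>P\<close> reaches the unit in the coordinate defining
    \<open>M\<close>, and the other terms of \<open>d\<close> are nonnegative there. If that
    coordinate vanishes on \<open>P\<close>, then M = 0.\<close>
  have Mz: "M \<le> z"
  proof -
    have "M \<in> (\<lambda>i. d i * u i) ` {..<n}"
      unfolding M_def using n by (intro Max_in) (auto simp: lessThan_empty_iff)
    then obtain i where i: "i < n" "M = d i * u i" by auto
    from i(1) show ?thesis
    proof (cases rule: unit_cases)
      case (pos x)
      have "d i * x $ i \<le> (\<Sum>i<n. d i * x $ i)"
        using i(1) d0 nonneg[OF pos(2)] by (intro member_le_sum) auto
      also have "\<dots> \<le> z" unfolding z_def using pos(2) by (rule p0(2))
      finally show ?thesis using i(2) pos(3) by simp
    next
      case zero
      then have "M = 0" using i(2) by (simp add: d_def)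
      then show ?thesis using z0 by simp
    qed
  qed

  define t where "t i = d i * u i / M" for i
  \<comment> \<open>For M = 0 the quotient \<open>t i\<close> is 0 by convention; the identity
    survives because every d_i u_i is then squeezed to 0.\<close>
  have Mt: "M * t i = d i * u i" if "i < n" for i
  proof (cases "M = 0")
    case True
    have "0 \<le> d i * u i" using d0 unit_pos[OF that] by (simp add: less_imp_le)
    then show ?thesis using True Mge[OF that] by simp
  qed (simp add: t_def)
  have t01: "0 \<le> t i" "t i \<le> 1" if "i < n" for i
  proof -
    have "0 \<le> d i * u i" using d0 unit_pos[OF that] by (simp add: less_imp_le)
    then show "0 \<le> t i" "t i \<le> 1"
      using M0 Mge[OF that] by (auto simp: t_def divide_le_eq_1)
  qed
  have "\<forall>i\<in>{..<n}. \<exists>a\<in>S. \<nu> * real_of_int a \<le> t i \<and> t i \<le> (1 + \<delta>) * (\<nu> * real_of_int a) + \<eta>"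
    using round t01 by auto
  then obtain a0 where a0: "\<And>i. i < n \<Longrightarrow> a0 i \<in> S \<and> \<nu> * real_of_int (a0 i) \<le> t i \<and>
      t i \<le> (1 + \<delta>) * (\<nu> * real_of_int (a0 i)) + \<eta>"
    by (metis lessThan_iff)
  define a where "a = restrict a0 {..<n}"
  have a: "a \<in> {..<n} \<rightarrow>\<^sub>E S" using a0 by (auto simp: a_def)
  have alo: "\<nu> * real_of_int (a i) \<le> t i"
    and ahi: "t i \<le> (1 + \<delta>) * (\<nu> * real_of_int (a i)) + \<eta>" if "i < n" for i
    using a0[OF that] that by (auto simp: a_def)
  \<comment> \<open>Rounding down keeps M \<nu> a_i \<le> d_i u_i, so on \<open>P\<close> the scaled
    objective of \<open>a\<close> stays below that of \<open>d\<close>.\<close>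
  have rhs: "M * \<nu> * rhs a \<le> z"
  proof -
    obtain x where x: "x \<in> P" "rhs a = (\<Sum>i<n. real_of_int (a i) / u i * x $ i)"
      by (rule rhs_attained[of a]) blast
    have "M * \<nu> * rhs a = (\<Sum>i<n. M * (\<nu> * real_of_int (a i)) * (x $ i / u i))"
      unfolding x(2) by (simp add: sum_distrib_left mult_ac)
    also have "\<dots> \<le> (\<Sum>i<n. M * t i * (x $ i / u i))"
      using alo M0 nonneg[OF x(1)] unit_pos
      by (intro sum_mono mult_right_mono mult_left_mono) (auto simp: less_imp_le)
    also have "\<dots> = (\<Sum>i<n. d i * x $ i)"
      using unit_pos by (intro sum.cong) (auto simp: Mt less_imp_neq[symmetric])
    also have "\<dots> \<le> z" unfolding z_def using x(1) by (rule p0(2))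
    finally show ?thesis .
  qed
  have q01: "0 \<le> q $ i / u i" "q $ i / u i \<le> 1" if i: "i < n" for i
  proof -
    obtain x where "x \<in> P" "q $ i \<le> x $ i"
      by (rule relaxation_coord_bound[OF S q(1) i])
    then have "q $ i \<le> u i" using le_unit[of x i] that by simp
    moreover have "0 \<le> q $ i" using q(1) that by (auto simp: relaxation_def)
    ultimately show "0 \<le> q $ i / u i" "q $ i / u i \<le> 1" using unit_pos[OF that] by auto
  qed
  have "(\<Sum>i<n. c $ i * q $ i) \<le> (\<Sum>i<n. d i * q $ i)"
    using q(1) by (intro sum_mono drop) auto
  also have "\<dots> = (\<Sum>i<n. M * (t i * (q $ i / u i)))"
    using unit_pos Mt by (intro sum.cong) (auto simp: less_imp_neq[symmetric] mult.assoc[symmetric])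
  \<comment> \<open>Rounding back up costs 1 + \<delta>, which is later charged to the inequality of
    \<open>a\<close> satisfied by \<open>q\<close>, and at most M \<eta> per coordinate, since q_i
    \<le> u_i.\<close>
  also have "\<dots> \<le> (\<Sum>i<n. M * (((1 + \<delta>) * (\<nu> * real_of_int (a i))) * (q $ i / u i) + \<eta>))"
  proof (intro sum_mono mult_left_mono M0)
    fix i assume "i \<in> {..<n}"
    then have i: "i < n" by simp
    have "t i * (q $ i / u i) \<le> ((1 + \<delta>) * (\<nu> * real_of_int (a i)) + \<eta>) * (q $ i / u i)"
      using ahi[OF i] q01[OF i] by (intro mult_right_mono) auto
    moreover have "\<eta> * (q $ i / u i) \<le> \<eta>"
      using q01[OF i] \<eta> by (intro mult_left_le) auto
    ultimately show "t i * (q $ i / u i) \<le> ((1 + \<delta>) * (\<nu> * real_of_int (a i))) * (q $ i / u i) + \<eta>"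
      unfolding distrib_right by linarith
  qed
  also have "\<dots> = (1 + \<delta>) * (M * \<nu> * (\<Sum>i<n. real_of_int (a i) / u i * q $ i)) + real n * \<eta> * M"
    by (simp add: sum.distrib sum_distrib_left distrib_left mult_ac)
  also have "\<dots> \<le> (1 + \<delta>) * (M * \<nu> * rhs a) + real n * \<eta> * M"
    using q(1) a M0 \<nu> \<delta> by (intro add_right_mono mult_left_mono) (auto simp: relaxation_def)
  also have "\<dots> \<le> (1 + \<delta>) * z + real n * \<eta> * z"
    using rhs Mz \<delta> \<eta> by (intro add_mono mult_left_mono) auto
  also have "\<dots> = (1 + (\<delta> + real n * \<eta>)) * z" by (simp add: algebra_simps)
  \<comment> \<open>The bound on the total error is chosen because 1 + \<epsilon>/(1 - \<epsilon>) =
    1/(1 - \<epsilon>).\<close>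
  also have "\<dots> \<le> (1 + \<epsilon> / (1 - \<epsilon>)) * z"
    using \<epsilon>(2) z0 by (intro mult_right_mono) auto
  also have "\<dots> = z / (1 - \<epsilon>)" using \<epsilon>(1) by (simp add: field_simps)
  finally have qz: "(1 - \<epsilon>) * (\<Sum>i<n. c $ i * q $ i) \<le> z"
    using \<epsilon>(1) by (simp add: field_simps)
  have qc: "q \<in> carrier_vec n" using q(1) by (simp add: relaxation_def)
  show "\<exists>p q. is_arg_max (\<lambda>x. c \<bullet> x) (\<lambda>x. x \<in> P) p \<and>
      is_arg_max (\<lambda>x. c \<bullet> x) (\<lambda>x. x \<in> relaxation S) q \<and> c \<bullet> p \<ge> (1 - \<epsilon>) * (c \<bullet> q)"
  proof (intro exI conjI)
    show "is_arg_max (\<lambda>x. c \<bullet> x) (\<lambda>x. x \<in> P) p"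
      unfolding is_arg_max_linorder
    proof (intro conjI allI impI)
      fix x assume "x \<in> P"
      then show "c \<bullet> x \<le> c \<bullet> p"
        using pmax[of x] cp dot[OF carrier[OF pP]] dot[OF carrier[of x]] by metis
    qed (rule pP)
    show "is_arg_max (\<lambda>x. c \<bullet> x) (\<lambda>x. x \<in> relaxation S) q"
      unfolding is_arg_max_linorder
    proof (intro conjI allI impI)
      fix x assume "x \<in> relaxation S"
      moreover from this have "x \<in> carrier_vec n" by (simp add: relaxation_def)
      ultimately show "c \<bullet> x \<le> c \<bullet> q"
        using q(2) dot[OF qc] dot[of x] by metis
    qed (rule q(1))
    show "c \<bullet> p \<ge> (1 - \<epsilon>) * (c \<bullet> q)"
      unfolding dot[OF carrier[OF pP]] dot[OF qc] cp by (rule qz)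
  qed
qed

section \<open>Linear descriptions of the relaxation\<close>

text \<open>Moving the division by u_i from the coefficient to the variable leaves the integer
  vectors of S^n as the rows of the matrix.\<close>

lemma relaxation_described_with_coeffs:
  assumes "{0, 1} \<subseteq> S" "finite S"
  shows "described_with_coeffs n P S (relaxation S)"
proof -
  let ?I = "{..<n} \<rightarrow>\<^sub>E S"
  have fin: "finite ?I" using assms(2) by (simp add: finite_PiE)
  obtain A b where A: "A \<in> carrier_mat (card ?I) n" "b \<in> carrier_vec (card ?I)"
    and el: "elements_mat A \<subseteq> {real_of_int (a i) |a i. a \<in> ?I \<and> i < n}"
    and sys: "\<And>y. y \<in> carrier_vec n \<Longrightarrow>
       A *\<^sub>v y \<le> b \<longleftrightarrow> (\<forall>a\<in>?I. (\<Sum>i<n. real_of_int (a i) * y $ i) \<le> rhs a)"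
    by (rule finite_system_as_matrix[OF fin, of n "\<lambda>a i. real_of_int (a i)" rhs]) blast
  have "elements_mat A \<subseteq> real_of_int ` S"
  proof
    fix x assume "x \<in> elements_mat A"
    then obtain a i where "x = real_of_int (a i)" "a \<in> ?I" "i < n" using el by blast
    moreover from this have "a i \<in> S" by auto
    ultimately show "x \<in> real_of_int ` S" by simp
  qed
  moreover have "relaxation S = {x \<in> carrier_vec n. 0\<^sub>v n \<le> x \<and> A *\<^sub>v normalize_coords P x \<le> b}"
    (is "_ = ?R")
  proof (rule Set.set_eqI)
    fix x
    show "x \<in> relaxation S \<longleftrightarrow> x \<in> ?R"
    proof (cases "x \<in> carrier_vec n")
      case True
      then have y: "normalize_coords P x \<in> carrier_vec n"
        by (simp add: normalize_coords_def)
      have "normalize_coords P x $ i = x $ i / u i" if "i < n" for i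
        using True that by (simp add: normalize_coords_def)
      then have "(\<Sum>i<n. real_of_int (a i) * normalize_coords P x $ i) =
          (\<Sum>i<n. real_of_int (a i) / u i * x $ i)" for a
        by (intro sum.cong) auto
      then show ?thesis
        unfolding mem_Collect_eq sys[OF y]
        using True by (auto simp: relaxation_def less_eq_vec_def)
    qed (simp add: relaxation_def)
  qed
  ultimately show ?thesis
    unfolding described_with_coeffs_def using A assms(1) by blast
qed

text \<open>In the original coordinates, \<open>Inl\<close> indexes the \<open>n\<close>
  nonnegativity constraints and \<open>Inr\<close> the |S|^n inequalities with coefficients a_i /
  u_i.\<close>

lemma relaxation_described_by:
  assumes "finite S"
  shows "described_by n (n + card S ^ n) (relaxation S)"
proof -
  let ?I = "{..<n} <+> ({..<n} \<rightarrow>\<^sub>E S)"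
  define \<alpha> where "\<alpha> k i = (case k of Inl j \<Rightarrow> if i = j then - 1 else 0
      | Inr a \<Rightarrow> real_of_int (a i) / u i)" for k :: "nat + (nat \<Rightarrow> int)" and i
  define \<beta> where "\<beta> k = (case k of Inl j \<Rightarrow> 0 | Inr a \<Rightarrow> rhs a)" for k :: "nat + (nat \<Rightarrow> int)"
  have fin: "finite ?I" using assms by (simp add: finite_PiE)
  have card: "card ?I = n + card S ^ n"
    using assms by (simp add: card_Plus card_PiE finite_PiE)
  have neg: "(\<Sum>i<n. (if i = j then - 1 else 0) * x $ i) = - (x $ j)" if "j < n" for j and x :: "real vec"
    using that by (simp add: if_distrib[of "\<lambda>x. x * _"] cong: if_cong)
  have "relaxation S = {x \<in> carrier_vec n. \<forall>k\<in>?I. (\<Sum>i<n. \<alpha> k i * x $ i) \<le> \<beta> k}"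
    by (auto simp: relaxation_def \<alpha>_def \<beta>_def ball_Un Plus_def neg)
  from finite_system_described_by[OF fin this] show ?thesis
    unfolding card .
qed

text \<open>Since n + 1 \<le> 2^n, the nonnegativity constraints are absorbed by doubling the base
  of the power.\<close>

lemma num_facets_relaxation_le:
  assumes "{0, 1} \<subseteq> S" "finite S"
  shows "num_facets n (relaxation S) \<le> (2 * card S) ^ n"
proof -
  have "1 \<le> card S" using assms card_gt_0_iff[of S] by auto
  then have "n * 1 \<le> n * card S ^ n" by (intro mult_left_mono) auto
  moreover have "(n + 1) * card S ^ n \<le> 2 ^ n * card S ^ n"
    using less_exp[of n] by (intro mult_right_mono) (simp_all add: Suc_le_eq)
  ultimately have "n + card S ^ n \<le> (2 * card S) ^ n"
    unfolding power_mult_distrib distrib_right by linarith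
  with num_facets_le[OF relaxation_described_by[OF assms(2)]] show ?thesis
    by (rule order_trans)
qed

end

section \<open>The choice of coefficients\<close>

text \<open>Keeps the logarithm away from 0, so that additive constants can be absorbed into
  \<open>coeff_rate\<close>. For n = 1 the limit condition forces \<epsilon> \<le> 5/6, and ln (6/5)
  \<ge> 1 - 5/6.\<close>

lemma ln_ratio_ge:
  fixes n :: nat and \<epsilon> :: real
  assumes "1 \<le> n" "0 < \<epsilon>" "\<epsilon> < 1" "2 \<le> n \<or> 1 \<le> coeff_limit n \<epsilon>"
  shows "1 / 6 \<le> ln (real n / \<epsilon>)"
proof -
  have "6 / 5 \<le> real n / \<epsilon>"
  proof (cases "2 \<le> n")
    case True
    then show ?thesis using assms by (simp add: field_simps)
  next
    case False
    then have "n = 1" using assms by simp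
    then show ?thesis using assms by (simp add: coeff_limit_def field_simps)
  qed
  then have "ln (6 / 5) \<le> ln (real n / \<epsilon>)" using assms by (subst ln_le_cancel_iff) auto
  moreover have "ln 1 - ln (6 / 5) \<le> (1 - 6 / 5) / (6 / 5 :: real)"
    by (intro ln_diff_le) auto
  ultimately show ?thesis by simp
qed

lemma coefficient_set:
  fixes n :: nat and \<epsilon> :: real
  assumes n: "1 \<le> n" and \<epsilon>: "0 < \<epsilon>" "\<epsilon> < 1" and lim: "1 \<le> coeff_limit n \<epsilon>"
  obtains S \<nu> \<delta> \<eta> where "{0, 1} \<subseteq> S" "finite S" "0 \<le> \<nu>" "0 \<le> \<delta>" "0 \<le> \<eta>"
    "\<And>t. 0 \<le> t \<Longrightarrow> t \<le> 1 \<Longrightarrow>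
      \<exists>a\<in>S. \<nu> * real_of_int a \<le> t \<and> t \<le> (1 + \<delta>) * (\<nu> * real_of_int a) + \<eta>"
    "\<delta> + real n * \<eta> \<le> \<epsilon> / (1 - \<epsilon>)"
    "real (card S) \<le> 212 * coeff_rate n \<epsilon>"
    "\<forall>a\<in>S. 0 \<le> a \<and> real_of_int a \<le> coeff_limit n \<epsilon>"
proof -
  \<comment> \<open>The error budget \<open>r\<close> is spent as r/4 on \<delta> and at most r/2 on
    the additive errors. The minimum with 1 keeps \<delta> \<le> 1/4 for the logarithmic
    count.\<close>
  define r where "r = \<epsilon> / (1 - \<epsilon>)"
  define \<delta> where "\<delta> = min r 1 / 4"
  define N where "N = nat \<lfloor>coeff_limit n \<epsilon>\<rfloor>"
  define S where "S = geometric_floors \<delta> N"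
  have r: "0 < r" using \<epsilon> by (simp add: r_def)
  have \<delta>: "0 < \<delta>" "\<delta> \<le> 1 / 4" "\<delta> \<le> r / 4" using r by (auto simp: \<delta>_def)
  have lim_r: "coeff_limit n \<epsilon> = 5 * real n / r"
    using \<epsilon> by (simp add: coeff_limit_def r_def)
  have N1: "1 \<le> N" and N_le: "real N \<le> coeff_limit n \<epsilon>"
    and N_gt: "coeff_limit n \<epsilon> < real N + 1"
    using lim unfolding N_def by linarith+
  have S_bounds: "S \<subseteq> {0..int N}"
    unfolding S_def using \<delta> by (intro geometric_floors_bounds) auto
  \<comment> \<open>Because N \<ge> 1, taking the integer part at most halves the limit: N + 1 \<le>
    2N.\<close>
  have "5 * real n / r \<le> 2 * real N" using N_gt N1 lim_r by linarith
  then have nN: "real n / real N \<le> 2 / 5 * r"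
    using r N1 by (simp add: field_simps)
  have "\<delta> + real n * ((1 + \<delta>) / real N) = \<delta> + (1 + \<delta>) * (real n / real N)" by simp
  also have "\<dots> \<le> r / 4 + (5 / 4) * (2 / 5 * r)"
    using \<delta> nN by (intro add_mono mult_mono) auto
  also have "\<dots> \<le> r" using r by simp
  finally have err: "\<delta> + real n * ((1 + \<delta>) / real N) \<le> \<epsilon> / (1 - \<epsilon>)" by (simp add: r_def)

  have l: "1 / 6 \<le> ln (real n / \<epsilon>)" using assms by (intro ln_ratio_ge) auto
  have limn: "coeff_limit n \<epsilon> \<le> 5 * (real n / \<epsilon>)"
    using n \<epsilon> by (simp add: coeff_limit_def divide_right_mono)
  have "1 \<le> real n / \<epsilon>" using n \<epsilon> by (simp add: le_divide_eq_1)
  then have "real (card S) \<le> 6 * (real n / \<epsilon>)"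
    using card_geometric_floors_le_Suc[of \<delta> N] \<delta> N_le limn unfolding S_def by linarith
  also have "\<dots> \<le> 212 * (1 / \<epsilon> * real n)" using \<epsilon> by (simp add: divide_right_mono)
  finally have card_n: "real (card S) \<le> 212 * (1 / \<epsilon> * real n)" .
  have "ln (real N) \<le> ln (5 * (real n / \<epsilon>))"
    using N_le limn N1 by (subst ln_le_cancel_iff) auto
  also have "\<dots> = ln 5 + ln (real n / \<epsilon>)" using n \<epsilon> by (subst ln_mult) auto
  also have "ln (5::real) \<le> 4" using ln_le_minus_one[of "5::real"] by simp
  \<comment> \<open>The constant is 25 = 1 + 24, from ln 5 \<le> 4 and 4 = 24 * (1/6).\<close>
  finally have lnN: "ln (real N) \<le> 25 * ln (real n / \<epsilon>)" using l by linarith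
  have inv: "1 / \<delta> \<le> 4 / \<epsilon>"
  proof -
    \<comment> \<open>Holds since \<epsilon>/(1 - \<epsilon>) \<ge> \<epsilon>. It converts
      1/\<delta> into a multiple of 1/\<epsilon>, even for \<epsilon> near 1.\<close>
    have "\<epsilon> \<le> min r 1" using \<epsilon> by (simp add: r_def field_simps)
    then have "\<epsilon> / 4 \<le> \<delta>" by (simp add: \<delta>_def)
    then have "1 / \<delta> \<le> 1 / (\<epsilon> / 4)" using \<epsilon> by (intro divide_left_mono mult_pos_pos \<delta>) auto
    then show ?thesis by simp
  qed
  have "real (card S) \<le> 2 + 2 * ln (real N) * (1 / \<delta>)"
    unfolding S_def using card_geometric_floors_le_ln[of \<delta> N] \<delta> N1 by simp
  moreover have "2 * ln (real N) * (1 / \<delta>) \<le> 2 * (25 * ln (real n / \<epsilon>)) * (4 / \<epsilon>)"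
    using inv lnN N1 \<delta> l by (intro mult_mono) auto
  moreover have "1 / 6 * 1 \<le> ln (real n / \<epsilon>) * (1 / \<epsilon>)"
    using l \<epsilon> by (intro mult_mono) auto
  \<comment> \<open>The constant is 212 = 12 + 2 * 25 * 4, where 12 comes from 2 = 12 *
    (1/6).\<close>
  ultimately have card_ln: "real (card S) \<le> 212 * (1 / \<epsilon> * ln (real n / \<epsilon>))" by simp
  have card: "real (card S) \<le> 212 * coeff_rate n \<epsilon>"
    using card_n card_ln by (simp add: coeff_rate_def min_def)

  show thesis
  proof (rule that[of S "1 / real N" \<delta> "(1 + \<delta>) / real N"])
    show "{0, 1} \<subseteq> S" unfolding S_def by (rule geometric_floors_0_1[OF N1])
    show "finite S" using S_bounds by (rule finite_subset) simp
    show "\<exists>a\<in>S. 1 / real N * real_of_int a \<le> t \<and>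
        t \<le> (1 + \<delta>) * (1 / real N * real_of_int a) + (1 + \<delta>) / real N"
      if "0 \<le> t" "t \<le> 1" for t
      unfolding S_def by (rule geometric_floors_round[OF \<delta>(1) N1 that])
    show "\<forall>a\<in>S. 0 \<le> a \<and> real_of_int a \<le> coeff_limit n \<epsilon>"
    proof
      fix a assume "a \<in> S"
      then have "0 \<le> a" "a \<le> int N" using S_bounds by auto
      then show "0 \<le> a \<and> real_of_int a \<le> coeff_limit n \<epsilon>" using N_le by linarith
    qed
  qed (use err card \<delta> in auto)
qed

text \<open>The coefficient claim presupposes that 1 does not exceed the limit. The facet claim also
  covers n \<ge> 2 with \<epsilon> near 1; for n = 1 the rate tends to 0 as \<epsilon> tends to 1,
  whereas a segment always has two facets. Nonemptiness of \<open>P\<close> makes the maxima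
  exist.\<close>

theorem theorem2:
  shows "\<exists>C::real. C > 0 \<and>
    (\<forall>n \<epsilon> P. 1 \<le> n \<and> 0 < \<epsilon> \<and> \<epsilon> < 1 \<and> is_polytope n P \<and> P \<noteq> {} \<and> down_monotone n P \<longrightarrow>
      (1 \<le> coeff_limit n \<epsilon> \<longrightarrow>
        (\<exists>Q S. approx_formulation n \<epsilon> P Q \<and> described_with_coeffs n P S Q \<and>
          finite S \<and> real (card S) \<le> C * coeff_rate n \<epsilon> \<and>
          (\<forall>a\<in>S. 0 \<le> a \<and> real_of_int a \<le> coeff_limit n \<epsilon>))) \<and>
      (2 \<le> n \<or> 1 \<le> coeff_limit n \<epsilon> \<longrightarrow>
        (\<exists>Q. approx_formulation n \<epsilon> P Q \<and> is_polyhedron n Q \<and>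
          real (num_facets n Q) \<le> (C * coeff_rate n \<epsilon>) ^ n)))"
\<comment> \<open>The constant 424 is twice 212, the doubling being the one in the facet
  count.\<close>
proof (intro exI[of _ "424::real"] conjI allI impI)
  fix n :: nat and \<epsilon> :: real and P :: "real vec set"
  assume asm: "1 \<le> n \<and> 0 < \<epsilon> \<and> \<epsilon> < 1 \<and> is_polytope n P \<and> P \<noteq> {} \<and> down_monotone n P"
  then have n: "1 \<le> n" and \<epsilon>: "0 < \<epsilon>" "\<epsilon> < 1" by auto
  interpret monotone_polytope n P using asm by unfold_locales auto
  have main: "\<exists>S. approx_formulation n \<epsilon> P (relaxation S) \<and> {0, 1} \<subseteq> S \<and>
      finite S \<and> real (card S) \<le> 212 * coeff_rate n \<epsilon> \<and>
      (\<forall>a\<in>S. 0 \<le> a \<and> real_of_int a \<le> coeff_limit n \<epsilon>)"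
    if lim: "1 \<le> coeff_limit n \<epsilon>"
  proof (rule coefficient_set[OF n \<epsilon> lim])
    fix S \<nu> \<delta> \<eta>
    assume S: "{0, 1} \<subseteq> S" "finite S" and pos: "0 \<le> \<nu>" "0 \<le> \<delta>" "0 \<le> \<eta>"
      and round: "\<And>t. 0 \<le> t \<Longrightarrow> t \<le> 1 \<Longrightarrow>
        \<exists>a\<in>S. \<nu> * real_of_int a \<le> t \<and> t \<le> (1 + \<delta>) * (\<nu> * real_of_int a) + \<eta>"
      and err: "\<delta> + real n * \<eta> \<le> \<epsilon> / (1 - \<epsilon>)"
      and card: "real (card S) \<le> 212 * coeff_rate n \<epsilon>"
        "\<forall>a\<in>S. 0 \<le> a \<and> real_of_int a \<le> coeff_limit n \<epsilon>"
    have "approx_formulation n \<epsilon> P (relaxation S)"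
      by (rule relaxation_approx[OF n S(1) pos round \<epsilon>(2) err])
    then show ?thesis using S card by blast
  qed
  {
    assume lim: "1 \<le> coeff_limit n \<epsilon>"
    obtain S where S: "approx_formulation n \<epsilon> P (relaxation S)" "{0, 1} \<subseteq> S" "finite S"
      "real (card S) \<le> 212 * coeff_rate n \<epsilon>"
      "\<forall>a\<in>S. 0 \<le> a \<and> real_of_int a \<le> coeff_limit n \<epsilon>"
      using main[OF lim] by blast
    have "real (card S) \<le> 424 * coeff_rate n \<epsilon>" using S(4) by linarith
    then show "\<exists>Q S. approx_formulation n \<epsilon> P Q \<and> described_with_coeffs n P S Q \<and>
          finite S \<and> real (card S) \<le> 424 * coeff_rate n \<epsilon> \<and>
          (\<forall>a\<in>S. 0 \<le> a \<and> real_of_int a \<le> coeff_limit n \<epsilon>)"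
      using S relaxation_described_with_coeffs[OF S(2,3)] by blast
  }
  assume large: "2 \<le> n \<or> 1 \<le> coeff_limit n \<epsilon>"
  obtain S where S: "approx_formulation n \<epsilon> P (relaxation S)" "{0, 1} \<subseteq> S" "finite S"
    "real (card S) \<le> 212 * coeff_rate n \<epsilon>"
  proof (cases "1 \<le> coeff_limit n \<epsilon>")
    case True
    then show thesis using main that by blast
  next
    case False
    \<comment> \<open>Here \<open>\<epsilon>\<close> is so close to 1 that the bounding box of \<open>P\<close> suffices.\<close>
    have "approx_formulation n \<epsilon> P (relaxation {0, 1})"
    \<comment> \<open>Every value in [0, 1] may be rounded to 0 with additive error 1; the budget
      allows this, as a limit below 1 means 5n < \<epsilon>/(1 - \<epsilon>).\<close>
    proof (rule relaxation_approx[where \<nu> = 1 and \<delta> = 0 and \<eta> = 1])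
      show "0 + real n * 1 \<le> \<epsilon> / (1 - \<epsilon>)"
        using False \<epsilon> n by (simp add: coeff_limit_def field_simps)
    qed (use n \<epsilon> in auto)
    moreover have "real (card {0, 1::int}) \<le> 212 * coeff_rate n \<epsilon>"
    proof -
      have "1 / 6 \<le> min (ln (real n / \<epsilon>)) (real n)"
        using ln_ratio_ge[OF n \<epsilon> large] n by simp
      then have "1 * (1 / 6) \<le> coeff_rate n \<epsilon>"
        unfolding coeff_rate_def using \<epsilon> by (intro mult_mono) auto
      then show ?thesis by simp
    qed
    ultimately show thesis by (intro that) auto
  qed
  have "real (num_facets n (relaxation S)) \<le> (2 * real (card S)) ^ n"
    using num_facets_relaxation_le[OF S(2,3)] by (metis of_nat_le_iff of_nat_mult of_nat_numeral of_nat_power)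
  also have "\<dots> \<le> (424 * coeff_rate n \<epsilon>) ^ n"
    using S(4) by (intro power_mono) auto
  finally show "\<exists>Q. approx_formulation n \<epsilon> P Q \<and> is_polyhedron n Q \<and>
      real (num_facets n Q) \<le> (424 * coeff_rate n \<epsilon>) ^ n"
    using S(1) relaxation_described_by[OF S(3)] unfolding is_polyhedron_def by blast
qed simp

end
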